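(* Let $\Gamma$ and $\Delta$ be finite nonempty sets, let $K\le\mathrm{Sym}(\Gamma)$ and $L\le\mathrm{Sym}(\Delta)$ be permutation groups, and let $m\ge 2$ be an integer. Let $k_m=|\mathrm{Orb}_m(K)|$ be the number of orbits of $K$ in its coordinatewise action on $\Gamma^m$, let $d=|\Delta|$ be the degree of $L$, and put $k=\min\{k_m,d\}$. Then $$(K\uparrow L)^{(m)}=K^{(m)}\uparrow L^{[k]}.$$
   Context: For a finite set $\Omega$, a group $G\le\mathrm{Sym}(\Omega)$ and a positive integer $m$: - The $m$-closure $G^{(m)}$ is the largest permutation group on $\Omega$ having the same orbits as $G$ in its induced coordinatewise action on the Cartesian power $\Omega^m$. - $\mathrm{Orb}_m(G)$ denotes the set of orbits of $G$ on $\Omega^m$. - $\Omega^{[m]}$ is the set of all ordered partitions $\Pi=(\Pi_1,\ldots,\Pi_r)$ of $\Omega$ (the classes $\Pi_i$ are nonempty, pairwise disjoint, with union $\Omega$) with $r\le m$ classes; a permutation $g$ acts by $\Pi^g=(\Pi_1^g,\ldots,\Pi_r^g)$. The group $G^{[m]}$ is the largest permutation group on $\Omega$ having the same orbits as $G$ in its induced action on $\Omega^{[m]}$. Permutations act on the right, written as exponents. Product action: for $K\le\mathrm{Sym}(\Gamma)$ and $L\le\mathrm{Sym}(\Delta)$ with $\Delta=\{1,\ldots,d\}$, $K\uparrow L$ denotes the permutation group on $\Gamma^d$ induced by the product action of the wreath product $K\wr L$. It consists of the permutations $g=(g_1,\ldots,g_d;\overline g)$ with $g_1,\ldots,g_d\in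 K$ and $\overline g\in L$, acting on $\omega=(\omega_1,\ldots,\omega_d)\in\Gamma^d$ by $$(\omega^g)_i=(\omega_{j})^{g_{j}},\quad j=i^{\overline g^{-1}},\quad 1\le i\le d.$$ *)

theory Defs
  imports "HOL-Algebra.Group_Action" "HOL-Library.Disjoint_Sets"
begin

text \<open>
  A permutation group on \<open>\<Omega>\<close> is a subgroup of \<open>BijGroup \<Omega>\<close>; its members are extensional,
  i.e. \<open>undefined\<close> outside \<open>\<Omega>\<close>, so equality of two permutation groups on \<open>\<Omega>\<close> is plain set
  equality. The image $\alpha^g$ is written \<open>g \<alpha>\<close>. The multiplication of \<open>BijGroup\<close> composes
  from right to left, which is opposite to the convention for right actions; this affects
  neither the subgroups of \<open>BijGroup \<Omega>\<close> nor the orbits.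
\<close>

abbreviation perm_group :: "'a set \<Rightarrow> ('a \<Rightarrow> 'a) set \<Rightarrow> bool" where
  "perm_group \<Omega> G \<equiv> subgroup G (BijGroup \<Omega>)"

abbreviation perm_monoid :: "'a set \<Rightarrow> ('a \<Rightarrow> 'a) set \<Rightarrow> ('a \<Rightarrow> 'a) monoid" where
  "perm_monoid \<Omega> G \<equiv> (BijGroup \<Omega>)\<lparr>carrier := G\<rparr>"

definition tuples :: "nat \<Rightarrow> 'a set \<Rightarrow> 'a list set" where
  "tuples m \<Omega> = {xs. set xs \<subseteq> \<Omega> \<and> length xs = m}"

definition Orb :: "nat \<Rightarrow> 'a set \<Rightarrow> ('a \<Rightarrow> 'a) set \<Rightarrow> 'a list set set" where
  "Orb m \<Omega> G = orbits (perm_monoid \<Omega> G) (tuples m \<Omega>) (\<lambda>g. \<lambda>xs\<in>tuples m \<Omega>. map g xs)"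

text \<open>\<open>Greatest\<close> refers to the inclusion order on sets of permutations.\<close>

definition m_closure :: "nat \<Rightarrow> 'a set \<Rightarrow> ('a \<Rightarrow> 'a) set \<Rightarrow> ('a \<Rightarrow> 'a) set" where
  "m_closure m \<Omega> G = (GREATEST H. perm_group \<Omega> H \<and> Orb m \<Omega> H = Orb m \<Omega> G)"

definition ordered_partitions :: "nat \<Rightarrow> 'a set \<Rightarrow> 'a set list set" where
  "ordered_partitions m \<Omega> = {P. partition_on \<Omega> (set P) \<and> distinct P \<and> length P \<le> m}"

definition part_Orb :: "nat \<Rightarrow> 'a set \<Rightarrow> ('a \<Rightarrow> 'a) set \<Rightarrow> 'a set list set set" where
  "part_Orb m \<Omega> G = orbits (perm_monoid \<Omega> G) (ordered_partitions m \<Omega>)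
     (\<lambda>g. \<lambda>P\<in>ordered_partitions m \<Omega>. map (image g) P)"

definition part_closure :: "nat \<Rightarrow> 'a set \<Rightarrow> ('a \<Rightarrow> 'a) set \<Rightarrow> ('a \<Rightarrow> 'a) set" where
  "part_closure m \<Omega> G = (GREATEST H. perm_group \<Omega> H \<and> part_Orb m \<Omega> H = part_Orb m \<Omega> G)"

text \<open>
  The Cartesian power $\Gamma^d$ with coordinates indexed by \<open>\<Delta>\<close> is \<open>\<Delta> \<rightarrow>\<^sub>E \<Gamma>\<close>, and
  \<open>product_perm \<Gamma> \<Delta> g s\<close> is the permutation induced on it by $(g_1,\ldots,g_d;s)$.
\<close>

definition product_perm ::
  "'a set \<Rightarrow> 'b set \<Rightarrow> ('b \<Rightarrow> 'a \<Rightarrow> 'a) \<Rightarrow> ('b \<Rightarrow> 'b) \<Rightarrow> ('b \<Rightarrow> 'a) \<Rightarrow> ('b \<Rightarrow> 'a)" where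
  "product_perm \<Gamma> \<Delta> g s =
     (\<lambda>\<omega>\<in>\<Delta> \<rightarrow>\<^sub>E \<Gamma>. \<lambda>i\<in>\<Delta>. let j = inv_into \<Delta> s i in g j (\<omega> j))"

definition product_action ::
  "'a set \<Rightarrow> 'b set \<Rightarrow> ('a \<Rightarrow> 'a) set \<Rightarrow> ('b \<Rightarrow> 'b) set \<Rightarrow> (('b \<Rightarrow> 'a) \<Rightarrow> ('b \<Rightarrow> 'a)) set" where
  "product_action \<Gamma> \<Delta> K L = {product_perm \<Gamma> \<Delta> g s | g s. g \<in> \<Delta> \<rightarrow>\<^sub>E K \<and> s \<in> L}"

end

theory Submission
  imports Defs
begin

text \<open>
  A permutation belongs to the closure of a group exactly if on each single tuple (or ordered
  partition) it agrees with some member of the group; \<open>m_closure_iff\<close> and \<open>part_closure_iff\<close> replace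
  the greatest groups by this criterion.

  View an \<open>m\<close>-tuple of points of \<open>\<Delta> \<rightarrow>\<^sub>E \<Gamma>\<close> as a matrix with columns indexed by \<open>\<Delta>\<close>, and colour each
  coordinate by the \<open>K\<close>-orbit of its column. Since the components of a member of the product action are
  chosen in \<open>K\<close> independently of each other, the orbits of the product action on matrices are the orbits of \<open>L\<close>
  on colourings of \<open>\<Delta>\<close> with colours in \<open>Orb m \<Gamma> K\<close> (\<open>product_action_orbit_iff\<close>), and every such colouring
  occurs. On the other hand, the partition closure of \<open>L\<close> consists of the permutations
  that agree with some member of \<open>L\<close> on each colouring with at most \<open>k\<close> colours
  (\<open>part_closure_imp_colouring\<close> and \<open>part_closure_of_colouring\<close>). As there are \<open>k_m\<close> colours available and at
  most \<open>d\<close> can be used at a time, the right bound is \<open>k = min k_m d\<close>.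

  This settles the theorem for permutations of the form \<open>(g; s)\<close>: such a permutation preserves the orbits on
  matrices if and only if each component of \<open>g\<close> lies in the \<open>m\<close>-closure of \<open>K\<close>, as seen from matrices with
  equal columns, and \<open>s\<close> lies in the partition closure of \<open>L\<close>. It remains to see that each member of
  the closure has this form, and here \<open>m \<ge> 2\<close> enters. Preserving orbits on pairs of points
  implies preserving the number of coordinates in which they differ, and an isometry of the Hamming
  space is a permutation of coordinates combined with a permutation of \<open>\<Gamma>\<close> in each coordinate
  (\<open>Hamming_isometry_imp_product_perm\<close>).
\<close>

section \<open>Permutation groups as sets of functions\<close>

lemma Bij_in: "g \<in> Bij \<Omega> \<Longrightarrow> x \<in> \<Omega> \<Longrightarrow> g x \<in> \<Omega>"
  using Bij_imp_funcset by blast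

lemma Bij_inj: "g \<in> Bij \<Omega> \<Longrightarrow> x \<in> \<Omega> \<Longrightarrow> y \<in> \<Omega> \<Longrightarrow> g x = g y \<longleftrightarrow> x = y"
  by (auto simp: Bij_def bij_betw_def inj_on_def)

lemma inv_into_Bij:
  assumes "g \<in> Bij \<Omega>" "x \<in> \<Omega>"
  shows "inv_into \<Omega> g (g x) = x" "g (inv_into \<Omega> g x) = x" "inv_into \<Omega> g x \<in> \<Omega>"
  using assms by (auto simp: Bij_def bij_betw_def f_inv_into_f inv_into_into)

lemma inv_BijGroup: "g \<in> Bij \<Omega> \<Longrightarrow> inv\<^bsub>BijGroup \<Omega>\<^esub> g = (\<lambda>x\<in>\<Omega>. inv_into \<Omega> g x)"
  by (rule group.inv_equality[OF group_BijGroup])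
    (simp_all add: BijGroup_def Bij_compose_restrict_eq restrict_inv_into_Bij)

lemma perm_groupD:
  assumes "perm_group \<Omega> G"
  shows "G \<subseteq> Bij \<Omega>" and "(\<lambda>x\<in>\<Omega>. x) \<in> G"
    and "g \<in> G \<Longrightarrow> h \<in> G \<Longrightarrow> compose \<Omega> g h \<in> G"
    and "g \<in> G \<Longrightarrow> (\<lambda>x\<in>\<Omega>. inv_into \<Omega> g x) \<in> G"
proof -
  show sub: "G \<subseteq> Bij \<Omega>" using subgroup.subset[OF assms] by (simp add: BijGroup_def)
  show "(\<lambda>x\<in>\<Omega>. x) \<in> G" using subgroup.one_closed[OF assms] by (simp add: BijGroup_def)
  show "g \<in> G \<Longrightarrow> h \<in> G \<Longrightarrow> compose \<Omega> g h \<in> G"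
    using subgroup.m_closed[OF assms, of g h] sub by (simp add: BijGroup_def subset_iff)
  show "g \<in> G \<Longrightarrow> (\<lambda>x\<in>\<Omega>. inv_into \<Omega> g x) \<in> G"
    using subgroup.m_inv_closed[OF assms, of g] sub by (simp add: inv_BijGroup subset_iff)
qed

lemma perm_groupI:
  assumes sub: "G \<subseteq> Bij \<Omega>" and one: "(\<lambda>x\<in>\<Omega>. x) \<in> G"
    and comp: "\<And>g h. g \<in> G \<Longrightarrow> h \<in> G \<Longrightarrow> compose \<Omega> g h \<in> G"
    and inv: "\<And>g. g \<in> G \<Longrightarrow> (\<lambda>x\<in>\<Omega>. inv_into \<Omega> g x) \<in> G"
  shows "perm_group \<Omega> G"
proof (rule group.subgroupI[OF group_BijGroup])
  show "G \<subseteq> carrier (BijGroup \<Omega>)" using sub by (simp add: BijGroup_def)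
  show "G \<noteq> {}" using one by auto
  show "inv\<^bsub>BijGroup \<Omega>\<^esub> g \<in> G" if "g \<in> G" for g
    using inv[OF that] that sub by (simp add: inv_BijGroup subset_iff)
  show "g \<otimes>\<^bsub>BijGroup \<Omega>\<^esub> h \<in> G" if "g \<in> G" "h \<in> G" for g h
    using comp[OF that] that sub by (simp add: BijGroup_def subset_iff)
qed

section \<open>The largest group with given orbits\<close>

text \<open>
  Orbits on tuples and orbits on ordered partitions obey the same formal rules, so the two closures
  are treated at once, with \<open>X\<close> standing for the set acted upon.
\<close>

locale induced_action =
  fixes \<Omega> :: "'a set" and X :: "'x set" and act :: "('a \<Rightarrow> 'a) \<Rightarrow> 'x \<Rightarrow> 'x"
  assumes act_closed: "g \<in> Bij \<Omega> \<Longrightarrow> x \<in> X \<Longrightarrow> act g x \<in> X"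
    and act_id: "x \<in> X \<Longrightarrow> act (\<lambda>a\<in>\<Omega>. a) x = x"
    and act_compose: "g \<in> Bij \<Omega> \<Longrightarrow> h \<in> Bij \<Omega> \<Longrightarrow> x \<in> X \<Longrightarrow> act (compose \<Omega> g h) x = act g (act h x)"
begin

definition orb :: "('a \<Rightarrow> 'a) set \<Rightarrow> 'x \<Rightarrow> 'x set" where
  "orb G x = (\<lambda>g. act g x) ` G"

lemma orbits_eq: "orbits (perm_monoid \<Omega> G) X (\<lambda>g. \<lambda>x\<in>X. act g x) = orb G ` X"
  by (auto simp: orbits_def orbit_def orb_def)

lemma orb_self: "perm_group \<Omega> G \<Longrightarrow> x \<in> X \<Longrightarrow> x \<in> orb G x"
  unfolding orb_def using act_id perm_groupD(2) by (metis image_eqI)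

text \<open>Two overlapping orbits coincide because \<open>G\<close> contains inverses.\<close>

lemma orb_eq:
  assumes G: "perm_group \<Omega> G" and x: "x \<in> X" and y: "y \<in> orb G x"
  shows "orb G y = orb G x"
proof -
  note sub = perm_groupD(1)[OF G, THEN subsetD]
  obtain g where g: "g \<in> G" "y = act g x" using y by (auto simp: orb_def)
  let ?g = "\<lambda>a\<in>\<Omega>. inv_into \<Omega> g a"
  have g': "?g \<in> G" using perm_groupD(4)[OF G] g by auto
  have "act ?g y = x"
    using act_compose[OF sub sub x, of ?g g] g g' sub x by (simp add: Bij_compose_restrict_eq act_id)
  then have yx: "act h x = act (compose \<Omega> h ?g) y" if "h \<in> G" for h
    using act_compose[of h ?g y] g g' that sub x by (simp add: act_closed)
  show ?thesis
  proof
    show "orb G y \<subseteq> orb G x"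
      unfolding orb_def using g sub x act_compose perm_groupD(3)[OF G]
      by (smt (verit) image_iff image_subset_iff)
    show "orb G x \<subseteq> orb G y"
      unfolding orb_def using yx perm_groupD(3)[OF G _ g'] by auto
  qed
qed

text \<open>
  The explicit form of the greatest element: a permutation belongs to it as soon as it moves no
  point of \<open>X\<close> out of its \<open>G\<close>-orbit.
\<close>

definition closure :: "('a \<Rightarrow> 'a) set \<Rightarrow> ('a \<Rightarrow> 'a) set" where
  "closure G = {g \<in> Bij \<Omega>. \<forall>x\<in>X. act g x \<in> orb G x}"

lemma perm_group_closure:
  assumes G: "perm_group \<Omega> G"
  shows "perm_group \<Omega> (closure G)"
proof (rule perm_groupI)
  show "closure G \<subseteq> Bij \<Omega>" by (auto simp: closure_def)
  show "(\<lambda>x\<in>\<Omega>. x) \<in> closure G" by (simp add: closure_def id_Bij act_id orb_self G)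
  show "compose \<Omega> g h \<in> closure G" if "g \<in> closure G" "h \<in> closure G" for g h
  proof -
    have "act (compose \<Omega> g h) x \<in> orb G x" if x: "x \<in> X" for x
    proof -
      have hx: "act h x \<in> orb G x" "act h x \<in> X"
        using \<open>h \<in> closure G\<close> x act_closed by (auto simp: closure_def)
      then have "act g (act h x) \<in> orb G (act h x)"
        using \<open>g \<in> closure G\<close> by (simp add: closure_def)
      then show ?thesis
        using that \<open>g \<in> closure G\<close> \<open>h \<in> closure G\<close> orb_eq[OF G x hx(1)]
        by (simp add: closure_def act_compose)
    qed
    then show ?thesis using that by (simp add: closure_def compose_Bij)
  qed
  show "(\<lambda>a\<in>\<Omega>. inv_into \<Omega> g a) \<in> closure G" if "g \<in> closure G" for g
  proof -
    let ?g = "\<lambda>a\<in>\<Omega>. inv_into \<Omega> g a"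
    have g: "g \<in> Bij \<Omega>" and g': "?g \<in> Bij \<Omega>"
      using that by (auto simp: closure_def restrict_inv_into_Bij)
    have "act ?g x \<in> orb G x" if x: "x \<in> X" for x
    proof -
      have y: "act ?g x \<in> X" using act_closed g' x by auto
      have "compose \<Omega> g ?g = (\<lambda>a\<in>\<Omega>. a)"
        using g by (auto simp: compose_def inv_into_Bij)
      then have "act g (act ?g x) = x" using act_compose[OF g g' x] by (simp add: act_id x)
      moreover have "act g (act ?g x) \<in> orb G (act ?g x)"
        using \<open>g \<in> closure G\<close> y by (simp add: closure_def)
      ultimately have "x \<in> orb G (act ?g x)" by simp
      from orb_eq[OF G y this] orb_self[OF G y] show ?thesis by simp
    qed
    then show ?thesis using g' by (auto simp: closure_def)
  qed
qed

text \<open>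
  A group \<open>H\<close> with the same set of orbits as \<open>G\<close> has the same orbit through each single point, since
  orbits of \<open>G\<close> are disjoint; hence \<open>H\<close> lies in the closure of \<open>G\<close>. Conversely the closure is itself a
  group, and it contains \<open>G\<close>.
\<close>

lemma Greatest_same_orbits:
  assumes G: "perm_group \<Omega> G"
  shows "(GREATEST H. perm_group \<Omega> H \<and>
      orbits (perm_monoid \<Omega> H) X (\<lambda>g. \<lambda>x\<in>X. act g x) =
      orbits (perm_monoid \<Omega> G) X (\<lambda>g. \<lambda>x\<in>X. act g x)) = closure G"
  unfolding orbits_eq
proof (rule Greatest_equality)
  have "orb (closure G) x = orb G x" if x: "x \<in> X" for x
  proof
    show "orb (closure G) x \<subseteq> orb G x" using x by (auto simp: orb_def closure_def)
    have "G \<subseteq> closure G" using perm_groupD(1)[OF G] by (auto simp: closure_def orb_def)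
    then show "orb G x \<subseteq> orb (closure G) x" by (auto simp: orb_def)
  qed
  then show "perm_group \<Omega> (closure G) \<and> orb (closure G) ` X = orb G ` X"
    using perm_group_closure[OF G] by simp
next
  fix H assume H: "perm_group \<Omega> H \<and> orb H ` X = orb G ` X"
  have "orb H x = orb G x" if x: "x \<in> X" for x
  proof -
    have "orb H x \<in> orb G ` X" using H x by blast
    then obtain y where y: "y \<in> X" "orb H x = orb G y" by auto
    moreover have "x \<in> orb H x" using H x orb_self by blast
    ultimately show ?thesis using orb_eq[OF G] by metis
  qed
  then have "act g x \<in> orb G x" if "g \<in> H" "x \<in> X" for g x
    using that by (auto simp: orb_def)
  then show "H \<le> closure G" using H perm_groupD(1)[of H \<Omega>] by (auto simp: closure_def)
qed

end

lemma induced_action_tuples: "induced_action \<Omega> (tuples m \<Omega>) map"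
proof
  show "map g x \<in> tuples m \<Omega>" if "g \<in> Bij \<Omega>" "x \<in> tuples m \<Omega>" for g x
    using that Bij_in[of g \<Omega>] by (auto simp: tuples_def)
  show "map (\<lambda>a\<in>\<Omega>. a) x = x" if "x \<in> tuples m \<Omega>" for x
    by (rule map_idI) (use that in \<open>auto simp: tuples_def\<close>)
  show "map (compose \<Omega> g h) x = map g (map h x)" if "x \<in> tuples m \<Omega>" for g h x
    using that by (auto simp: tuples_def compose_def)
qed

lemma induced_action_partitions: "induced_action \<Omega> (ordered_partitions m \<Omega>) (\<lambda>g. map (image g))"
proof
  show "map (image g) P \<in> ordered_partitions m \<Omega>"
    if g: "g \<in> Bij \<Omega>" and P: "P \<in> ordered_partitions m \<Omega>" for g P
  proof -
    have b: "bij_betw g \<Omega> \<Omega>" and p: "partition_on \<Omega> (set P)" "distinct P"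
      using g P by (auto simp: Bij_def ordered_partitions_def)
    have "inj_on (image g) (set P)"
      by (rule inj_on_subset[OF inj_on_image_Pow]) (use b p in \<open>auto simp: bij_betw_def partition_on_def\<close>)
    moreover have "image g ` set P - {{}} = image g ` set P"
      using p by (auto simp: partition_on_def)
    then have "partition_on (g ` \<Omega>) (image g ` set P)"
      using partition_on_inj_image[of \<Omega> "set P" g] b p
      by (simp add: bij_betw_def)
    ultimately show ?thesis using P b by (auto simp: ordered_partitions_def distinct_map bij_betw_def)
  qed
  show "map (image (\<lambda>a\<in>\<Omega>. a)) P = P" if "P \<in> ordered_partitions m \<Omega>" for P
  proof (rule map_idI)
    show "(\<lambda>a\<in>\<Omega>. a) ` B = B" if "B \<in> set P" for B
      using that \<open>P \<in> _\<close> by (force simp: ordered_partitions_def partition_on_def)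
  qed
  show "map (image (compose \<Omega> g h)) P = map (image g) (map (image h) P)"
    if "P \<in> ordered_partitions m \<Omega>" for g h P
  proof -
    have "B \<subseteq> \<Omega>" if "B \<in> set P" for B
      using that \<open>P \<in> _\<close> by (auto simp: ordered_partitions_def partition_on_def)
    then have "compose \<Omega> g h ` B = g ` (h ` B)" if "B \<in> set P" for B
      using that by (auto simp: compose_def image_image intro!: image_cong)
    then show ?thesis by simp
  qed
qed

interpretation on_tuples: induced_action \<Omega> "tuples m \<Omega>" map for \<Omega> m
  by (rule induced_action_tuples)

interpretation on_partitions: induced_action \<Omega> "ordered_partitions m \<Omega>" "\<lambda>g. map (image g)" for \<Omega> m
  by (rule induced_action_partitions)

lemma m_closure_eq: "perm_group \<Omega> G \<Longrightarrow> m_closure m \<Omega> G = on_tuples.closure \<Omega> m G"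
  unfolding m_closure_def Orb_def by (rule on_tuples.Greatest_same_orbits)

lemma part_closure_eq: "perm_group \<Omega> G \<Longrightarrow> part_closure m \<Omega> G = on_partitions.closure \<Omega> m G"
  unfolding part_closure_def part_Orb_def by (rule on_partitions.Greatest_same_orbits)

lemma perm_group_m_closure: "perm_group \<Omega> G \<Longrightarrow> perm_group \<Omega> (m_closure m \<Omega> G)"
  by (simp add: m_closure_eq on_tuples.perm_group_closure)

lemma perm_group_part_closure: "perm_group \<Omega> G \<Longrightarrow> perm_group \<Omega> (part_closure m \<Omega> G)"
  by (simp add: part_closure_eq on_partitions.perm_group_closure)

lemma m_closure_iff: "perm_group \<Omega> G \<Longrightarrow>
    g \<in> m_closure m \<Omega> G \<longleftrightarrow> g \<in> Bij \<Omega> \<and> (\<forall>u\<in>tuples m \<Omega>. \<exists>h\<in>G. map g u = map h u)"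
  by (simp add: m_closure_eq on_tuples.closure_def on_tuples.orb_def image_iff)

lemma part_closure_iff: "perm_group \<Omega> G \<Longrightarrow>
    g \<in> part_closure m \<Omega> G \<longleftrightarrow> g \<in> Bij \<Omega> \<and>
      (\<forall>P\<in>ordered_partitions m \<Omega>. \<exists>h\<in>G. map (image g) P = map (image h) P)"
  by (simp add: part_closure_eq on_partitions.closure_def on_partitions.orb_def image_iff)

section \<open>Ordered partitions as colourings\<close>

text \<open>
  The classes of an ordered partition are the fibres of a colouring, listed in some order of the
  colours. If \<open>s\<close> and \<open>t\<close> agree on the ordered partition into the fibres of \<open>c \<circ> s\<close>, which \<open>s\<close> carries to
  those of \<open>c\<close>, then \<open>c \<circ> t = c \<circ> s\<close>.
\<close>

lemma part_closure_imp_colouring: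
  assumes L: "perm_group \<Delta> L" and fin: "finite \<Delta>"
    and s: "s \<in> part_closure k \<Delta> L" and c: "card (c ` \<Delta>) \<le> k"
  shows "\<exists>t\<in>L. \<forall>j\<in>\<Delta>. c (t j) = c (s j)"
proof -
  have sB: "s \<in> Bij \<Delta>" using s part_closure_iff[OF L] by blast
  then have sD: "s ` \<Delta> = \<Delta>" by (auto simp: Bij_def bij_betw_def)
  obtain cs where cs: "set cs = c ` \<Delta>" "distinct cs"
    using finite_distinct_list fin by (metis finite_imageI)
  define cell where "cell v = {j\<in>\<Delta>. c (s j) = v}" for v
  have ne: "cell v \<noteq> {}" if "v \<in> set cs" for v
  proof -
    have "v \<in> c ` s ` \<Delta>" using that cs sD by simp
    then show ?thesis by (auto simp: cell_def)
  qed
  have "inj_on cell (set cs)"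
  proof (rule inj_onI)
    fix v w assume "v \<in> set cs" "w \<in> set cs" "cell v = cell w"
    then show "v = w" using ne[of v] by (auto simp: cell_def)
  qed
  moreover have "partition_on \<Delta> (cell ` set cs)"
  proof (rule partition_onI)
    show "\<Union> (cell ` set cs) = \<Delta>" using cs Bij_in[OF sB] by (auto simp: cell_def)
    show "disjnt p q" if "p \<in> cell ` set cs" "q \<in> cell ` set cs" "p \<noteq> q" for p q
      using that by (auto simp: cell_def disjnt_def)
    show "{} \<notin> cell ` set cs" using ne by auto
  qed
  moreover have "length cs \<le> k" using c cs by (metis distinct_card)
  ultimately have "map cell cs \<in> ordered_partitions k \<Delta>"
    using cs by (simp add: ordered_partitions_def distinct_map)
  then obtain t where t: "t \<in> L" "map (image s) (map cell cs) = map (image t) (map cell cs)"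
    using s part_closure_iff[OF L] by blast
  have "c (t j) = c (s j)" if j: "j \<in> \<Delta>" for j
  proof -
    have v: "c (s j) \<in> set cs" "j \<in> cell (c (s j))"
      using j cs Bij_in[OF sB] by (auto simp: cell_def)
    then have "t j \<in> s ` cell (c (s j))" using t by auto
    then show ?thesis by (auto simp: cell_def)
  qed
  then show ?thesis using t by blast
qed

text \<open>
  The colouring that detects a given partition \<open>P\<close> gives \<open>i\<close> the class of \<open>P\<close> that contains the preimage
  of \<open>i\<close> under \<open>s\<close>; this is why the colours are sets of points.
\<close>

lemma part_closure_of_colouring:
  fixes s :: "'b \<Rightarrow> 'b"
  assumes L: "perm_group \<Delta> L" and fin: "finite \<Delta>" and sB: "s \<in> Bij \<Delta>"
    and colour: "\<And>c :: 'b \<Rightarrow> 'b set. card (c ` \<Delta>) \<le> k \<Longrightarrow> \<exists>t\<in>L. \<forall>j\<in>\<Delta>. c (t j) = c (s j)"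
  shows "s \<in> part_closure k \<Delta> L"
proof -
  have "\<exists>t\<in>L. map (image s) P = map (image t) P" if P: "P \<in> ordered_partitions k \<Delta>" for P
  proof -
    have part: "partition_on \<Delta> (set P)" and len: "length P \<le> k"
      using P by (auto simp: ordered_partitions_def)
    \<comment> \<open>the class of \<open>P\<close> that contains \<open>j\<close>\<close>
    define cell where "cell j = (THE B. B \<in> set P \<and> j \<in> B)" for j
    have cell_eq: "cell j = B" if "B \<in> set P" "j \<in> B" for B j
      unfolding cell_def using that part by (intro the_equality) (auto simp: partition_on_def disjoint_def)
    have cell: "cell j \<in> set P \<and> j \<in> cell j" if "j \<in> \<Delta>" for j
      using that part cell_eq by (auto simp: partition_on_def)
    define c where "c i = cell (inv_into \<Delta> s i)" for i
    have "c ` \<Delta> \<subseteq> set P" using cell inv_into_Bij(3)[OF sB] by (auto simp: c_def)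
    then have "card (c ` \<Delta>) \<le> k"
      using len card_length[of P] card_mono[of "set P" "c ` \<Delta>"] by simp
    then obtain t where t: "t \<in> L" "\<And>j. j \<in> \<Delta> \<Longrightarrow> c (t j) = c (s j)"
      using colour by blast
    have tB: "t \<in> Bij \<Delta>" using t perm_groupD(1)[OF L] by blast
    have "s ` B = t ` B" if B: "B \<in> set P" for B
    proof -
      have BD: "B \<subseteq> \<Delta>" using B part by (auto simp: partition_on_def)
      have "t j \<in> s ` B" if j: "j \<in> B" for j
      proof -
        have jD: "j \<in> \<Delta>" using j BD by blast
        have "c (t j) = B" using t(2)[OF jD] cell_eq[OF B j] by (simp add: c_def inv_into_Bij(1)[OF sB jD])
        then have "inv_into \<Delta> s (t j) \<in> B"
          using cell inv_into_Bij(3)[OF sB Bij_in[OF tB jD]] by (auto simp: c_def)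
        then show ?thesis using inv_into_Bij(2)[OF sB Bij_in[OF tB jD]] by (metis image_eqI)
      qed
      then have sub: "t ` B \<subseteq> s ` B" by blast
      \<comment> \<open>both images have the size of \<open>B\<close>, so the inclusion is an equality\<close>
      have "inj_on s B" "inj_on t B"
        using sB tB BD by (auto simp: Bij_def bij_betw_def intro: inj_on_subset)
      then have "card (t ` B) = card (s ` B)" by (simp add: card_image)
      then show ?thesis
        using card_subset_eq[OF _ sub] finite_subset[OF BD fin] by simp
    qed
    then show ?thesis using t(1) by auto
  qed
  then show ?thesis using sB part_closure_iff[OF L] by blast
qed

section \<open>The product action is a permutation group\<close>

text \<open>
  Reading the image at the coordinate \<open>s j\<close> removes the inverse of \<open>s\<close> from the definition.
\<close>

lemma product_perm_apply:
  assumes "s \<in> Bij \<Delta>" "\<omega> \<in> \<Delta> \<rightarrow>\<^sub>E \<Gamma>" "j \<in> \<Delta>"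
  shows "product_perm \<Gamma> \<Delta> g s \<omega> (s j) = g j (\<omega> j)"
  using assms by (simp add: product_perm_def Let_def Bij_in inv_into_Bij)

lemma product_perm_eqI:
  assumes s: "s \<in> Bij \<Delta>"
    and f: "f \<in> extensional (\<Delta> \<rightarrow>\<^sub>E \<Gamma>)" "\<And>\<omega>. \<omega> \<in> \<Delta> \<rightarrow>\<^sub>E \<Gamma> \<Longrightarrow> f \<omega> \<in> extensional \<Delta>"
    and eq: "\<And>\<omega> j. \<omega> \<in> \<Delta> \<rightarrow>\<^sub>E \<Gamma> \<Longrightarrow> j \<in> \<Delta> \<Longrightarrow> f \<omega> (s j) = g j (\<omega> j)"
  shows "f = product_perm \<Gamma> \<Delta> g s"
proof (rule extensionalityI[OF f(1)])
  show "product_perm \<Gamma> \<Delta> g s \<in> extensional (\<Delta> \<rightarrow>\<^sub>E \<Gamma>)" by (simp add: product_perm_def)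
  fix \<omega> assume w: "\<omega> \<in> \<Delta> \<rightarrow>\<^sub>E \<Gamma>"
  show "f \<omega> = product_perm \<Gamma> \<Delta> g s \<omega>"
  proof (rule extensionalityI[OF f(2)[OF w]])
    show "product_perm \<Gamma> \<Delta> g s \<omega> \<in> extensional \<Delta>" using w by (simp add: product_perm_def)
    fix i assume "i \<in> \<Delta>"
    then have "i = s (inv_into \<Delta> s i)" "inv_into \<Delta> s i \<in> \<Delta>" by (simp_all add: inv_into_Bij[OF s])
    then show "f \<omega> i = product_perm \<Gamma> \<Delta> g s \<omega> i"
      using eq[OF w] product_perm_apply[OF s w] by metis
  qed
qed

lemma product_perm_closed:
  assumes "s \<in> Bij \<Delta>" "g \<in> \<Delta> \<rightarrow> Bij \<Gamma>" "\<omega> \<in> \<Delta> \<rightarrow>\<^sub>E \<Gamma>"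
  shows "product_perm \<Gamma> \<Delta> g s \<omega> \<in> \<Delta> \<rightarrow>\<^sub>E \<Gamma>"
  using assms inv_into_Bij(3)[OF assms(1)] by (auto simp: product_perm_def Let_def Pi_iff PiE_iff Bij_in)

text \<open>
  The multiplication of the wreath product: the entry at \<open>j\<close> is first moved to the coordinate \<open>t j\<close>, so it
  then meets the component of \<open>g\<close> with index \<open>t j\<close>.
\<close>

lemma product_perm_compose:
  assumes s: "s \<in> Bij \<Delta>" "g \<in> \<Delta> \<rightarrow> Bij \<Gamma>"
    and t: "t \<in> Bij \<Delta>" "h \<in> \<Delta> \<rightarrow> Bij \<Gamma>"
  shows "compose (\<Delta> \<rightarrow>\<^sub>E \<Gamma>) (product_perm \<Gamma> \<Delta> g s) (product_perm \<Gamma> \<Delta> h t) =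
    product_perm \<Gamma> \<Delta> (\<lambda>j\<in>\<Delta>. compose \<Gamma> (g (t j)) (h j)) (compose \<Delta> s t)"
proof (rule product_perm_eqI)
  show "compose \<Delta> s t \<in> Bij \<Delta>" using s t by (simp add: compose_Bij)
  note ht = product_perm_closed[OF t]
  note gs = product_perm_closed[OF s]
  show "compose (\<Delta> \<rightarrow>\<^sub>E \<Gamma>) (product_perm \<Gamma> \<Delta> g s) (product_perm \<Gamma> \<Delta> h t) \<omega> \<in> extensional \<Delta>"
    if "\<omega> \<in> \<Delta> \<rightarrow>\<^sub>E \<Gamma>" for \<omega>
    using gs[OF ht[OF that]] that by (simp add: compose_eq PiE_iff)
  show "compose (\<Delta> \<rightarrow>\<^sub>E \<Gamma>) (product_perm \<Gamma> \<Delta> g s) (product_perm \<Gamma> \<Delta> h t) \<omega> (compose \<Delta> s t j) =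
      (\<lambda>j\<in>\<Delta>. compose \<Gamma> (g (t j)) (h j)) j (\<omega> j)"
    if w: "\<omega> \<in> \<Delta> \<rightarrow>\<^sub>E \<Gamma>" and j: "j \<in> \<Delta>" for \<omega> j
  proof -
    have "\<omega> j \<in> \<Gamma>" using w j by blast
    then show ?thesis
      using w j s t product_perm_apply[OF s(1) ht[OF w] Bij_in[OF t(1) j]] product_perm_apply[OF t(1) w j]
      by (simp add: compose_eq)
  qed
qed (simp add: compose_def)

lemma product_perm_id: "product_perm \<Gamma> \<Delta> (\<lambda>j\<in>\<Delta>. \<lambda>x\<in>\<Gamma>. x) (\<lambda>j\<in>\<Delta>. j) = (\<lambda>\<omega>\<in>\<Delta> \<rightarrow>\<^sub>E \<Gamma>. \<omega>)"
  by (rule product_perm_eqI[symmetric]) (auto simp: id_Bij PiE_iff)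

lemma product_actionI:
  "g \<in> \<Delta> \<rightarrow>\<^sub>E K \<Longrightarrow> s \<in> L \<Longrightarrow> product_perm \<Gamma> \<Delta> g s \<in> product_action \<Gamma> \<Delta> K L"
  unfolding product_action_def by blast

lemma product_actionE:
  assumes "f \<in> product_action \<Gamma> \<Delta> K L" "perm_group \<Gamma> K" "perm_group \<Delta> L"
  obtains g s where "g \<in> \<Delta> \<rightarrow>\<^sub>E K" "g \<in> \<Delta> \<rightarrow> Bij \<Gamma>" "s \<in> L" "s \<in> Bij \<Delta>" "f = product_perm \<Gamma> \<Delta> g s"
proof -
  obtain g s where gs: "g \<in> \<Delta> \<rightarrow>\<^sub>E K" "s \<in> L" "f = product_perm \<Gamma> \<Delta> g s"
    using assms(1) unfolding product_action_def by blast
  moreover have "g \<in> \<Delta> \<rightarrow> Bij \<Gamma>" "s \<in> Bij \<Delta>"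
    using gs perm_groupD(1)[OF assms(2)] perm_groupD(1)[OF assms(3)] by blast+
  ultimately show thesis using that by blast
qed

lemma product_action_one:
  assumes "perm_group \<Gamma> K" "perm_group \<Delta> L"
  shows "(\<lambda>\<omega>\<in>\<Delta> \<rightarrow>\<^sub>E \<Gamma>. \<omega>) \<in> product_action \<Gamma> \<Delta> K L"
  unfolding product_perm_id[symmetric]
  using perm_groupD(2)[OF assms(1)] perm_groupD(2)[OF assms(2)] by (intro product_actionI) auto

text \<open>
  The inverse of \<open>(g; s)\<close> is found by moving the coordinates back: its component at \<open>i\<close> undoes the
  component of \<open>g\<close> at the preimage of \<open>i\<close> under \<open>s\<close>.
\<close>

lemma product_action_inverse:
  assumes K: "perm_group \<Gamma> K" and L: "perm_group \<Delta> L" and f: "f \<in> product_action \<Gamma> \<Delta> K L"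
  obtains f' where "f' \<in> product_action \<Gamma> \<Delta> K L"
    and "compose (\<Delta> \<rightarrow>\<^sub>E \<Gamma>) f' f = (\<lambda>\<omega>\<in>\<Delta> \<rightarrow>\<^sub>E \<Gamma>. \<omega>)" and "compose (\<Delta> \<rightarrow>\<^sub>E \<Gamma>) f f' = (\<lambda>\<omega>\<in>\<Delta> \<rightarrow>\<^sub>E \<Gamma>. \<omega>)"
proof -
  obtain g s where gK: "g \<in> \<Delta> \<rightarrow>\<^sub>E K" and g: "g \<in> \<Delta> \<rightarrow> Bij \<Gamma>" and sL: "s \<in> L" and s: "s \<in> Bij \<Delta>"
    and f: "f = product_perm \<Gamma> \<Delta> g s"
    using product_actionE[OF f K L] by blast
  define s' where "s' = (\<lambda>i\<in>\<Delta>. inv_into \<Delta> s i)"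
  define g' where "g' = (\<lambda>i\<in>\<Delta>. \<lambda>x\<in>\<Gamma>. inv_into \<Gamma> (g (s' i)) x)"
  have s'L: "s' \<in> L" using perm_groupD(4)[OF L sL] by (simp add: s'_def)
  then have s': "s' \<in> Bij \<Delta>" using perm_groupD(1)[OF L] by blast
  have g'K: "g' \<in> \<Delta> \<rightarrow>\<^sub>E K"
    unfolding g'_def using gK Bij_in[OF s'] by (auto intro!: perm_groupD(4)[OF K] dest: PiE_mem)
  then have g': "g' \<in> \<Delta> \<rightarrow> Bij \<Gamma>" using perm_groupD(1)[OF K] by blast
  have gB: "g j \<in> Bij \<Gamma>" if "j \<in> \<Delta>" for j using g that by blast
  have ss: "s' (s j) = j" "s (s' j) = j" if "j \<in> \<Delta>" for j
    using that s by (simp_all add: s'_def inv_into_Bij Bij_in)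
  show thesis
  proof (rule that)
    show "product_perm \<Gamma> \<Delta> g' s' \<in> product_action \<Gamma> \<Delta> K L"
      by (rule product_actionI[OF g'K s'L])
    have "compose \<Delta> s' s = (\<lambda>j\<in>\<Delta>. j)" using ss by (auto simp: compose_def)
    moreover have "(\<lambda>j\<in>\<Delta>. compose \<Gamma> (g' (s j)) (g j)) = (\<lambda>j\<in>\<Delta>. \<lambda>x\<in>\<Gamma>. x)"
      using ss Bij_in[OF s] Bij_in[OF gB] inv_into_Bij[OF gB] by (auto simp: g'_def compose_def intro!: restrict_ext)
    ultimately show "compose (\<Delta> \<rightarrow>\<^sub>E \<Gamma>) (product_perm \<Gamma> \<Delta> g' s') f = (\<lambda>\<omega>\<in>\<Delta> \<rightarrow>\<^sub>E \<Gamma>. \<omega>)"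
      unfolding f product_perm_compose[OF s' g' s g] by (simp add: product_perm_id)
    have "compose \<Delta> s s' = (\<lambda>j\<in>\<Delta>. j)" using ss by (auto simp: compose_def)
    moreover have "(\<lambda>j\<in>\<Delta>. compose \<Gamma> (g (s' j)) (g' j)) = (\<lambda>j\<in>\<Delta>. \<lambda>x\<in>\<Gamma>. x)"
      using Bij_in[OF s'] inv_into_Bij[OF gB] by (auto simp: g'_def compose_def intro!: restrict_ext)
    ultimately show "compose (\<Delta> \<rightarrow>\<^sub>E \<Gamma>) f (product_perm \<Gamma> \<Delta> g' s') = (\<lambda>\<omega>\<in>\<Delta> \<rightarrow>\<^sub>E \<Gamma>. \<omega>)"
      unfolding f product_perm_compose[OF s g s' g'] by (simp add: product_perm_id)
  qed
qed

text \<open>Bijectivity is read off from the two-sided inverse.\<close>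

lemma product_action_subset_Bij:
  assumes K: "perm_group \<Gamma> K" and L: "perm_group \<Delta> L"
  shows "product_action \<Gamma> \<Delta> K L \<subseteq> Bij (\<Delta> \<rightarrow>\<^sub>E \<Gamma>)"
proof
  fix f assume f: "f \<in> product_action \<Gamma> \<Delta> K L"
  have closed: "h \<in> extensional (\<Delta> \<rightarrow>\<^sub>E \<Gamma>) \<and> (\<forall>\<omega>\<in>\<Delta> \<rightarrow>\<^sub>E \<Gamma>. h \<omega> \<in> \<Delta> \<rightarrow>\<^sub>E \<Gamma>)"
    if h: "h \<in> product_action \<Gamma> \<Delta> K L" for h
  proof -
    obtain g s where "g \<in> \<Delta> \<rightarrow> Bij \<Gamma>" "s \<in> Bij \<Delta>" and h: "h = product_perm \<Gamma> \<Delta> g s"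
      using product_actionE[OF h K L] by blast
    then show ?thesis using product_perm_closed[of s \<Delta> g \<Gamma>]
      by (simp add: h) (simp add: product_perm_def)
  qed
  obtain f' where f': "f' \<in> product_action \<Gamma> \<Delta> K L"
    and eq: "compose (\<Delta> \<rightarrow>\<^sub>E \<Gamma>) f' f = (\<lambda>\<omega>\<in>\<Delta> \<rightarrow>\<^sub>E \<Gamma>. \<omega>)" "compose (\<Delta> \<rightarrow>\<^sub>E \<Gamma>) f f' = (\<lambda>\<omega>\<in>\<Delta> \<rightarrow>\<^sub>E \<Gamma>. \<omega>)"
    using product_action_inverse[OF K L f] by blast
  have "bij_betw f (\<Delta> \<rightarrow>\<^sub>E \<Gamma>) (\<Delta> \<rightarrow>\<^sub>E \<Gamma>)"
  proof (rule bij_betw_byWitness[where f' = f'])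
    show "\<forall>\<omega>\<in>\<Delta> \<rightarrow>\<^sub>E \<Gamma>. f' (f \<omega>) = \<omega>" using fun_cong[OF eq(1)] by (metis compose_eq restrict_apply')
    show "\<forall>\<omega>\<in>\<Delta> \<rightarrow>\<^sub>E \<Gamma>. f (f' \<omega>) = \<omega>" using fun_cong[OF eq(2)] by (metis compose_eq restrict_apply')
  qed (use closed[OF f] closed[OF f'] in \<open>simp_all add: image_subset_iff\<close>)
  then show "f \<in> Bij (\<Delta> \<rightarrow>\<^sub>E \<Gamma>)" using closed[OF f] by (simp add: Bij_def)
qed

lemma perm_group_product_action:
  assumes K: "perm_group \<Gamma> K" and L: "perm_group \<Delta> L"
  shows "perm_group (\<Delta> \<rightarrow>\<^sub>E \<Gamma>) (product_action \<Gamma> \<Delta> K L)"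
proof (rule perm_groupI[OF product_action_subset_Bij[OF K L] product_action_one[OF K L]])
  note B = product_action_subset_Bij[OF K L, THEN subsetD]
  fix f assume f: "f \<in> product_action \<Gamma> \<Delta> K L"
  show "compose (\<Delta> \<rightarrow>\<^sub>E \<Gamma>) f h \<in> product_action \<Gamma> \<Delta> K L" if h: "h \<in> product_action \<Gamma> \<Delta> K L" for h
  proof -
    obtain g s where gs: "g \<in> \<Delta> \<rightarrow>\<^sub>E K" "g \<in> \<Delta> \<rightarrow> Bij \<Gamma>" "s \<in> L" "s \<in> Bij \<Delta>" "f = product_perm \<Gamma> \<Delta> g s"
      using product_actionE[OF f K L] by blast
    obtain g' s' where gs': "g' \<in> \<Delta> \<rightarrow>\<^sub>E K" "g' \<in> \<Delta> \<rightarrow> Bij \<Gamma>" "s' \<in> L" "s' \<in> Bij \<Delta>"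
        "h = product_perm \<Gamma> \<Delta> g' s'"
      using product_actionE[OF h K L] by blast
    have "(\<lambda>j\<in>\<Delta>. compose \<Gamma> (g (s' j)) (g' j)) \<in> \<Delta> \<rightarrow>\<^sub>E K"
      using gs(1) gs'(1) Bij_in[OF gs'(4)] by (auto intro!: perm_groupD(3)[OF K] dest: PiE_mem)
    then show ?thesis
      unfolding gs(5) gs'(5) product_perm_compose[OF gs(4,2) gs'(4,2)]
      by (rule product_actionI) (rule perm_groupD(3)[OF L gs(3) gs'(3)])
  qed
  show "(\<lambda>\<omega>\<in>\<Delta> \<rightarrow>\<^sub>E \<Gamma>. inv_into (\<Delta> \<rightarrow>\<^sub>E \<Gamma>) f \<omega>) \<in> product_action \<Gamma> \<Delta> K L"
  proof -
    obtain f' where f': "f' \<in> product_action \<Gamma> \<Delta> K L"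
      and eq: "compose (\<Delta> \<rightarrow>\<^sub>E \<Gamma>) f' f = (\<lambda>\<omega>\<in>\<Delta> \<rightarrow>\<^sub>E \<Gamma>. \<omega>)"
      using product_action_inverse[OF K L f] by blast
    have "inv\<^bsub>BijGroup (\<Delta> \<rightarrow>\<^sub>E \<Gamma>)\<^esub> f = f'"
      by (rule group.inv_equality[OF group_BijGroup])
        (use eq B[OF f] B[OF f'] in \<open>simp_all add: BijGroup_def\<close>)
    then show ?thesis using inv_BijGroup[OF B[OF f]] f' by simp
  qed
qed

section \<open>Isometries of the Hamming space\<close>

text \<open>The size of this set is the Hamming distance of \<open>x\<close> and \<open>y\<close>.\<close>

definition differing :: "'b set \<Rightarrow> ('b \<Rightarrow> 'a) \<Rightarrow> ('b \<Rightarrow> 'a) \<Rightarrow> 'b set" where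
  "differing \<Delta> x y = {i\<in>\<Delta>. x i \<noteq> y i}"

lemma differing_upd:
  "j \<in> \<Delta> \<Longrightarrow> differing \<Delta> x (b(j := v)) =
    (if x j = v then differing \<Delta> x b - {j} else insert j (differing \<Delta> x b))"
  by (auto simp: differing_def)

lemma differing_empty:
  "x \<in> \<Delta> \<rightarrow>\<^sub>E \<Gamma> \<Longrightarrow> y \<in> \<Delta> \<rightarrow>\<^sub>E \<Gamma> \<Longrightarrow> differing \<Delta> x y = {} \<longleftrightarrow> x = y"
  by (auto simp: differing_def intro: PiE_ext)

lemma product_perm_isometry:
  assumes s: "s \<in> Bij \<Delta>" and g: "g \<in> \<Delta> \<rightarrow> Bij \<Gamma>" and x: "x \<in> \<Delta> \<rightarrow>\<^sub>E \<Gamma>" and y: "y \<in> \<Delta> \<rightarrow>\<^sub>E \<Gamma>"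
  shows "card (differing \<Delta> (product_perm \<Gamma> \<Delta> g s x) (product_perm \<Gamma> \<Delta> g s y)) = card (differing \<Delta> x y)"
proof -
  let ?F = "product_perm \<Gamma> \<Delta> g s"
  have iff: "?F x (s j) = ?F y (s j) \<longleftrightarrow> x j = y j" if j: "j \<in> \<Delta>" for j
  proof -
    have "g j \<in> Bij \<Gamma>" "x j \<in> \<Gamma>" "y j \<in> \<Gamma>" using g x y j by blast+
    then show ?thesis
      by (simp add: product_perm_apply[OF s x j] product_perm_apply[OF s y j] Bij_inj)
  qed
  have "bij_betw s \<Delta> \<Delta>" using s by (simp add: Bij_def)
  moreover have "s ` differing \<Delta> x y = differing \<Delta> (?F x) (?F y)"
  proof -
    have "differing \<Delta> (?F x) (?F y) = {i \<in> s ` \<Delta>. ?F x i \<noteq> ?F y i}"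
      using \<open>bij_betw s \<Delta> \<Delta>\<close> by (simp add: differing_def bij_betw_def)
    also have "\<dots> = s ` differing \<Delta> x y" using iff by (auto simp: differing_def)
    finally show ?thesis by simp
  qed
  ultimately have "bij_betw s (differing \<Delta> x y) (differing \<Delta> (?F x) (?F y))"
    by (metis (no_types, lifting) bij_betw_subset differing_def mem_Collect_eq subsetI)
  then show ?thesis by (simp add: bij_betw_same_card)
qed

text \<open>
  Fix the constant function \<open>a\<close> with value \<open>a0\<close>. The points \<open>a(i := \<gamma>)\<close> with \<open>\<gamma>\<close> varying form a line
  through \<open>a\<close>, and any two of them are at distance at most one. An isometry must therefore map the line
  in direction \<open>i\<close> to a line through \<open>f a\<close>; its direction is \<open>s i\<close>, and \<open>g i\<close> is the induced map on
  coordinates. Points other than \<open>a\<close> on lines of different directions are at distance two, which makes \<open>s\<close> injective.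

  At an arbitrary point \<open>x\<close> the value of \<open>f\<close> follows from distances: the entry \<open>x i\<close> is recognised by
  comparing the distance from \<open>x\<close> to \<open>a\<close> with that from \<open>x\<close> to \<open>a(i := \<gamma>)\<close>. It decreases exactly if
  \<open>x i = \<gamma> \<noteq> a0\<close>, and it increases exactly if \<open>x i = a0 \<noteq> \<gamma>\<close>.

  If \<open>\<Gamma>\<close> has at most one element, the space has at most one point; then \<open>f\<close> is the identity,
  and no direction can be read off from it.
\<close>

lemma Hamming_isometry_imp_product_perm:
  fixes \<Gamma> :: "'a set" and \<Delta> :: "'b set"
  assumes \<Gamma>: "finite \<Gamma>" and \<Delta>: "finite \<Delta>" and fe: "f \<in> extensional (\<Delta> \<rightarrow>\<^sub>E \<Gamma>)"
    and fc: "\<And>x. x \<in> \<Delta> \<rightarrow>\<^sub>E \<Gamma> \<Longrightarrow> f x \<in> \<Delta> \<rightarrow>\<^sub>E \<Gamma>"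
    and iso: "\<And>x y. x \<in> \<Delta> \<rightarrow>\<^sub>E \<Gamma> \<Longrightarrow> y \<in> \<Delta> \<rightarrow>\<^sub>E \<Gamma> \<Longrightarrow>
      card (differing \<Delta> (f x) (f y)) = card (differing \<Delta> x y)"
  obtains g s where "g \<in> \<Delta> \<rightarrow>\<^sub>E Bij \<Gamma>" "s \<in> Bij \<Delta>" "f = product_perm \<Gamma> \<Delta> g s"
proof (cases "\<exists>a0\<in>\<Gamma>. \<exists>b0\<in>\<Gamma>. a0 \<noteq> b0")
  case False
  have "f x = x" if x: "x \<in> \<Delta> \<rightarrow>\<^sub>E \<Gamma>" for x
    by (rule PiE_ext[OF fc[OF x] x]) (use False x fc[OF x] in blast)
  then have "f = product_perm \<Gamma> \<Delta> (\<lambda>j\<in>\<Delta>. \<lambda>x\<in>\<Gamma>. x) (\<lambda>j\<in>\<Delta>. j)"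
    unfolding product_perm_id using fe by (intro extensionalityI[OF fe]) auto
  then show ?thesis by (rule that[rotated 2]) (auto simp: id_Bij)
next
  case True
  then obtain a0 b0 where ab: "a0 \<in> \<Gamma>" "b0 \<in> \<Gamma>" "b0 \<noteq> a0" by metis
  let ?D = "differing \<Delta>"
  have fin: "finite (?D x y)" for x y :: "'b \<Rightarrow> 'a" using \<Delta> by (simp add: differing_def)
  define a where "a = (\<lambda>i\<in>\<Delta>. a0)"
  have a: "a \<in> \<Delta> \<rightarrow>\<^sub>E \<Gamma>" using ab by (auto simp: a_def)
  have N: "a(i := \<gamma>) \<in> \<Delta> \<rightarrow>\<^sub>E \<Gamma>" if "i \<in> \<Delta>" "\<gamma> \<in> \<Gamma>" for i \<gamma>
    using that ab by (auto simp: a_def PiE_iff extensional_def)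
  have Na: "a(i := a0) = a" if "i \<in> \<Delta>" for i using that by (auto simp: a_def)
  have D1: "card (?D (f (a(i := \<gamma>))) (f a)) = 1" if i: "i \<in> \<Delta>" and \<gamma>: "\<gamma> \<in> \<Gamma>" "\<gamma> \<noteq> a0" for i \<gamma>
  proof -
    have "?D (a(i := \<gamma>)) a = {i}" using i \<gamma> by (auto simp: differing_def a_def)
    then show ?thesis using iso[OF N[OF i \<gamma>(1)] a] by simp
  qed
  \<comment> \<open>The image of the single point \<open>a(i := b0)\<close> defines the direction of the image of its line.\<close>
  have "\<forall>i\<in>\<Delta>. \<exists>j. ?D (f (a(i := b0))) (f a) = {j}"
    using D1 ab by (meson card_1_singletonE)
  then obtain s where s: "\<And>i. i \<in> \<Delta> \<Longrightarrow> ?D (f (a(i := b0))) (f a) = {s i}" by metis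
  have s\<Delta>: "s i \<in> \<Delta>" if "i \<in> \<Delta>" for i using s[OF that] by (auto simp: differing_def)
  have line: "?D (f (a(i := \<gamma>))) (f a) \<subseteq> {s i}" if i: "i \<in> \<Delta>" and \<gamma>: "\<gamma> \<in> \<Gamma>" for i \<gamma>
  proof (cases "\<gamma> = a0")
    case True
    then show ?thesis using Na[OF i] by (simp add: differing_def)
  next
    case False
    then obtain j where j: "?D (f (a(i := \<gamma>))) (f a) = {j}"
      using D1[OF i \<gamma>] by (meson card_1_singletonE)
    show ?thesis
    proof (rule ccontr)
      assume "\<not> ?thesis"
      then have ne: "j \<noteq> s i" using j by simp
      \<comment> \<open>Two neighbours of \<open>f a\<close> in different directions are at distance two.\<close>
      have "{j, s i} \<subseteq> ?D (f (a(i := \<gamma>))) (f (a(i := b0)))"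
        using j s[OF i] ne by (fastforce simp: differing_def set_eq_iff)
      from card_mono[OF fin this] have "2 \<le> card (?D (f (a(i := \<gamma>))) (f (a(i := b0))))"
        using ne by simp
      also have "\<dots> = card (?D (a(i := \<gamma>)) (a(i := b0)))" by (rule iso[OF N[OF i \<gamma>] N[OF i ab(2)]])
      also have "\<dots> \<le> card {i}" by (rule card_mono) (auto simp: differing_def)
      finally show False by simp
    qed
  qed
  define g where "g = (\<lambda>i\<in>\<Delta>. \<lambda>\<gamma>\<in>\<Gamma>. f (a(i := \<gamma>)) (s i))"
  have fN: "f (a(i := \<gamma>)) = (f a)(s i := g i \<gamma>)" if i: "i \<in> \<Delta>" and \<gamma>: "\<gamma> \<in> \<Gamma>" for i \<gamma>
  proof
    fix k
    show "f (a(i := \<gamma>)) k = ((f a)(s i := g i \<gamma>)) k"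
    proof (cases "k \<in> \<Delta>")
      case True
      then show ?thesis using line[OF i \<gamma>] i \<gamma> by (auto simp: g_def differing_def)
    next
      case False
      then have "k \<noteq> s i" using s\<Delta>[OF i] by blast
      then show ?thesis
        using PiE_arb[OF fc[OF a] False] PiE_arb[OF fc[OF N[OF i \<gamma>]] False] by simp
    qed
  qed
  have gB: "g i \<in> Bij \<Gamma>" if i: "i \<in> \<Delta>" for i
  proof -
    have "inj_on (g i) \<Gamma>"
    proof (rule inj_onI)
      fix \<gamma> \<gamma>' assume \<gamma>: "\<gamma> \<in> \<Gamma>" "\<gamma>' \<in> \<Gamma>" and eq: "g i \<gamma> = g i \<gamma>'"
      have "card (?D (a(i := \<gamma>)) (a(i := \<gamma>'))) = card (?D (f (a(i := \<gamma>))) (f (a(i := \<gamma>'))))"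
        using iso N i \<gamma> by simp
      also have "\<dots> = 0" using fN[OF i] \<gamma> eq by (simp add: differing_def)
      finally have "?D (a(i := \<gamma>)) (a(i := \<gamma>')) = {}" using fin by simp
      then have "a(i := \<gamma>) = a(i := \<gamma>')" using differing_empty N[OF i] \<gamma> by metis
      then show "\<gamma> = \<gamma>'" by (metis fun_upd_same)
    qed
    moreover have "g i ` \<Gamma> \<subseteq> \<Gamma>" using fc[OF N[OF i]] s\<Delta>[OF i] i by (auto simp: g_def)
    ultimately have "bij_betw (g i) \<Gamma> \<Gamma>"
      using \<Gamma> by (simp add: bij_betw_def endo_inj_surj)
    then show ?thesis using i by (simp add: Bij_def g_def)
  qed
  have "inj_on s \<Delta>"
  proof (rule inj_onI, rule ccontr)
    fix i i' assume i: "i \<in> \<Delta>" "i' \<in> \<Delta>" and eq: "s i = s i'" and ne: "i \<noteq> i'"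
    have "?D (a(i := b0)) (a(i' := b0)) = {i, i'}"
      using i ne ab by (auto simp: differing_def a_def)
    then have "2 = card (?D (f (a(i := b0))) (f (a(i' := b0))))"
      using iso[OF N N, of i b0 i' b0] i ab ne by simp
    also have "\<dots> \<le> card {s i}"
      using fN[OF i(1) ab(2)] fN[OF i(2) ab(2)] eq by (intro card_mono) (auto simp: differing_def)
    finally show False by simp
  qed
  then have "bij_betw s \<Delta> \<Delta>"
    using \<Delta> s\<Delta> by (simp add: bij_betw_def endo_inj_surj image_subset_iff)
  \<comment> \<open>The values of \<open>s\<close> outside \<open>\<Delta>\<close> are arbitrary so far, but members of \<open>Bij \<Delta>\<close> are extensional.\<close>
  define s' where "s' = restrict s \<Delta>"
  have s'B: "s' \<in> Bij \<Delta>"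
    using \<open>bij_betw s \<Delta> \<Delta>\<close> by (simp add: Bij_def s'_def cong: bij_betw_cong)
  have key: "f x (s i) = g i (x i)" if x: "x \<in> \<Delta> \<rightarrow>\<^sub>E \<Gamma>" and i: "i \<in> \<Delta>" for x i
  proof (rule ccontr)
    assume ne: "f x (s i) \<noteq> g i (x i)"
    have xi: "x i \<in> \<Gamma>" using x i by blast
    have dist: "card (?D (f x) ((f a)(s i := g i \<gamma>))) = card (?D x (a(i := \<gamma>)))" if "\<gamma> \<in> \<Gamma>" for \<gamma>
      using iso[OF x N[OF i that]] fN[OF i that] by simp
    show False
    proof (cases "x i = a0")
      case False
      have "card (?D x (a(i := x i))) < card (?D x a)"
        unfolding differing_upd[OF i] using False i card_Diff1_less[OF fin, of i x a]
        by (simp add: differing_def a_def)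
      moreover have "card (?D (f x) (f a)) \<le> card (?D (f x) ((f a)(s i := g i (x i))))"
        using ne fin by (intro card_mono) (auto simp: differing_def)
      ultimately show False using dist[OF xi] iso[OF x a] by simp
    next
      case True
      have "(f a) (s i) = g i a0" using fN[OF i ab(1)] Na[OF i] by (metis fun_upd_same)
      then have "?D (f x) ((f a)(s i := g i b0)) \<subseteq> ?D (f x) (f a)"
        using ne True by (auto simp: differing_def)
      then have "card (?D (f x) ((f a)(s i := g i b0))) \<le> card (?D (f x) (f a))"
        using fin by (intro card_mono)
      moreover have "card (?D x (a(i := b0))) = Suc (card (?D x a))"
        unfolding differing_upd[OF i] using True ab i card_insert_disjoint[OF fin, of i x a]
        by (simp add: differing_def a_def)
      ultimately show False using dist[OF ab(2)] iso[OF x a] by simp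
    qed
  qed
  have "f = product_perm \<Gamma> \<Delta> g s'"
  proof (rule product_perm_eqI[OF s'B fe])
    show "f \<omega> \<in> extensional \<Delta>" if "\<omega> \<in> \<Delta> \<rightarrow>\<^sub>E \<Gamma>" for \<omega> using fc[OF that] by (simp add: PiE_iff)
    show "f \<omega> (s' j) = g j (\<omega> j)" if "\<omega> \<in> \<Delta> \<rightarrow>\<^sub>E \<Gamma>" "j \<in> \<Delta>" for \<omega> j
      using key that by (simp add: s'_def)
  qed
  moreover have "g \<in> \<Delta> \<rightarrow>\<^sub>E Bij \<Gamma>" using gB by (simp add: PiE_iff g_def)
  ultimately show ?thesis using that s'B by blast
qed

section \<open>Orbits of the product action on tuples\<close>

text \<open>
  An \<open>m\<close>-tuple of points of \<open>\<Delta> \<rightarrow>\<^sub>E \<Gamma>\<close> is a matrix with \<open>m\<close> rows, whose columns are \<open>m\<close>-tuples over \<open>\<Gamma>\<close>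
  indexed by \<open>\<Delta>\<close>. The product action permutes the columns and applies a permutation of \<open>\<Gamma>\<close> to each.
\<close>

definition column :: "('b \<Rightarrow> 'a) list \<Rightarrow> 'b \<Rightarrow> 'a list" where
  "column A j = map (\<lambda>\<omega>. \<omega> j) A"

definition from_columns :: "nat \<Rightarrow> 'b set \<Rightarrow> ('b \<Rightarrow> 'a list) \<Rightarrow> ('b \<Rightarrow> 'a) list" where
  "from_columns m \<Delta> u = map (\<lambda>r. \<lambda>j\<in>\<Delta>. u j ! r) [0..<m]"

lemma column_tuples:
  "A \<in> tuples m (\<Delta> \<rightarrow>\<^sub>E \<Gamma>) \<Longrightarrow> j \<in> \<Delta> \<Longrightarrow> column A j \<in> tuples m \<Gamma>"
  by (auto simp: tuples_def column_def)

lemma from_columns_tuples: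
  assumes "u \<in> \<Delta> \<rightarrow> tuples m \<Gamma>"
  shows "from_columns m \<Delta> u \<in> tuples m (\<Delta> \<rightarrow>\<^sub>E \<Gamma>)"
  using assms by (force simp: tuples_def from_columns_def Pi_iff)

lemma column_from_columns:
  assumes "u \<in> \<Delta> \<rightarrow> tuples m \<Gamma>" "j \<in> \<Delta>"
  shows "column (from_columns m \<Delta> u) j = u j"
proof -
  have "length (u j) = m" using assms by (auto simp: tuples_def)
  then show ?thesis using assms(2) by (auto simp: column_def from_columns_def intro: nth_equalityI)
qed

lemma column_product_perm:
  assumes "s \<in> Bij \<Delta>" "A \<in> tuples m (\<Delta> \<rightarrow>\<^sub>E \<Gamma>)" "j \<in> \<Delta>"
  shows "column (map (product_perm \<Gamma> \<Delta> g s) A) (s j) = map (g j) (column A j)"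
proof -
  have "product_perm \<Gamma> \<Delta> g s \<omega> (s j) = g j (\<omega> j)" if "\<omega> \<in> set A" for \<omega>
    by (rule product_perm_apply[OF assms(1) _ assms(3)]) (use that assms(2) in \<open>auto simp: tuples_def\<close>)
  then show ?thesis by (simp add: column_def)
qed

lemma Orb_eq: "Orb m \<Omega> G = on_tuples.orb G ` tuples m \<Omega>"
  by (simp add: Orb_def on_tuples.orbits_eq)

lemma finite_Orb: "finite \<Omega> \<Longrightarrow> finite (Orb m \<Omega> G)"
  unfolding Orb_eq tuples_def by (intro finite_imageI finite_lists_length_eq)

text \<open>
  Colour each coordinate by the \<open>K\<close>-orbit of its column. Two matrices are in the same orbit of the product
  action precisely if some member of \<open>L\<close> carries one colouring to the other, because the components
  at different coordinates can be chosen in \<open>K\<close> independently.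
\<close>

lemma product_action_orbit_iff:
  assumes K: "perm_group \<Gamma> K" and L: "perm_group \<Delta> L"
    and A: "A \<in> tuples m (\<Delta> \<rightarrow>\<^sub>E \<Gamma>)" and B: "B \<in> tuples m (\<Delta> \<rightarrow>\<^sub>E \<Gamma>)"
  shows "(\<exists>F\<in>product_action \<Gamma> \<Delta> K L. B = map F A) \<longleftrightarrow>
    (\<exists>t\<in>L. \<forall>j\<in>\<Delta>. on_tuples.orb K (column B (t j)) = on_tuples.orb K (column A j))"
proof
  assume "\<exists>F\<in>product_action \<Gamma> \<Delta> K L. B = map F A"
  then obtain F where F: "F \<in> product_action \<Gamma> \<Delta> K L" "B = map F A" by blast
  obtain h t where h: "h \<in> \<Delta> \<rightarrow>\<^sub>E K" and t: "t \<in> L" "t \<in> Bij \<Delta>" and Fht: "F = product_perm \<Gamma> \<Delta> h t"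
    using product_actionE[OF F(1) K L] by blast
  have "on_tuples.orb K (column B (t j)) = on_tuples.orb K (column A j)" if j: "j \<in> \<Delta>" for j
  proof (rule on_tuples.orb_eq[OF K column_tuples[OF A j]])
    show "column B (t j) \<in> on_tuples.orb K (column A j)"
      unfolding F(2) Fht column_product_perm[OF t(2) A j] on_tuples.orb_def using h j by blast
  qed
  then show "\<exists>t\<in>L. \<forall>j\<in>\<Delta>. on_tuples.orb K (column B (t j)) = on_tuples.orb K (column A j)" using t by blast
next
  assume "\<exists>t\<in>L. \<forall>j\<in>\<Delta>. on_tuples.orb K (column B (t j)) = on_tuples.orb K (column A j)"
  then obtain t where t: "t \<in> L" "\<And>j. j \<in> \<Delta> \<Longrightarrow> on_tuples.orb K (column B (t j)) = on_tuples.orb K (column A j)"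
    by blast
  have tB: "t \<in> Bij \<Delta>" using t(1) perm_groupD(1)[OF L] by blast
  have "\<exists>h\<in>K. column B (t j) = map h (column A j)" if j: "j \<in> \<Delta>" for j
    using on_tuples.orb_self[OF K column_tuples[OF B Bij_in[OF tB j]]] t(2)[OF j] by (auto simp: on_tuples.orb_def)
  then obtain h where h: "\<And>j. j \<in> \<Delta> \<Longrightarrow> h j \<in> K"
      "\<And>j. j \<in> \<Delta> \<Longrightarrow> column B (t j) = map (h j) (column A j)" by metis
  define h' where "h' = restrict h \<Delta>"
  have h': "h' \<in> \<Delta> \<rightarrow>\<^sub>E K" "h' \<in> \<Delta> \<rightarrow> Bij \<Gamma>"
    using h perm_groupD(1)[OF K] by (auto simp: h'_def)
  let ?F = "product_perm \<Gamma> \<Delta> h' t"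
  have len: "length A = m" "length B = m" using A B by (auto simp: tuples_def)
  have "B = map ?F A"
  proof (rule nth_equalityI)
    fix r assume r: "r < length B"
    have rows: "A ! r \<in> \<Delta> \<rightarrow>\<^sub>E \<Gamma>" "B ! r \<in> \<Delta> \<rightarrow>\<^sub>E \<Gamma>"
      using A B r len nth_mem[of r A] nth_mem[of r B] by (simp_all add: tuples_def subset_iff)
    have "B ! r = ?F (A ! r)"
    proof (rule PiE_ext[OF rows(2) product_perm_closed[OF tB h'(2) rows(1)]])
      fix i assume "i \<in> \<Delta>"
      then obtain j where j: "j \<in> \<Delta>" "i = t j" using tB by (auto simp: Bij_def bij_betw_def)
      have "(B ! r) (t j) = column B (t j) ! r" using r by (simp add: column_def)
      also have "\<dots> = h j ((A ! r) j)" using h(2)[OF j(1)] r len by (simp add: column_def)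
      also have "\<dots> = ?F (A ! r) (t j)"
        using product_perm_apply[OF tB rows(1) j(1)] j(1) by (simp add: h'_def)
      finally show "(B ! r) i = ?F (A ! r) i" using j(2) by simp
    qed
    then show "B ! r = map ?F A ! r" using r len by simp
  qed (simp add: len)
  then show "\<exists>F\<in>product_action \<Gamma> \<Delta> K L. B = map F A" using product_actionI[OF h'(1) t(1)] by blast
qed

text \<open>
  Components in the \<open>m\<close>-closure of \<open>K\<close> do not change colours, so such a permutation acts on colourings
  through \<open>s\<close> alone.
\<close>

lemma column_product_perm_orb:
  assumes K: "perm_group \<Gamma> K" and s: "s \<in> Bij \<Delta>" and A: "A \<in> tuples m (\<Delta> \<rightarrow>\<^sub>E \<Gamma>)" and j: "j \<in> \<Delta>"
    and g: "g j \<in> m_closure m \<Gamma> K"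
  shows "on_tuples.orb K (column (map (product_perm \<Gamma> \<Delta> g s) A) (s j)) = on_tuples.orb K (column A j)"
  unfolding column_product_perm[OF s A j]
proof (rule on_tuples.orb_eq[OF K column_tuples[OF A j]])
  show "map (g j) (column A j) \<in> on_tuples.orb K (column A j)"
    using g column_tuples[OF A j] unfolding m_closure_iff[OF K] on_tuples.orb_def by blast
qed

section \<open>The closure of the product action\<close>

text \<open>
  The colouring of the image of a matrix uses at most \<open>card (Orb m \<Gamma> K)\<close> colours, and at most
  \<open>card \<Delta>\<close> of them occur; so it is coarse enough for \<open>L\<close> to imitate \<open>s\<close> on it.
\<close>

lemma product_action_closures_le:
  assumes \<Delta>: "finite \<Delta>" and \<Gamma>: "finite \<Gamma>" and K: "perm_group \<Gamma> K" and L: "perm_group \<Delta> L"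
    and k: "min (card (Orb m \<Gamma> K)) (card \<Delta>) \<le> k"
  shows "product_action \<Gamma> \<Delta> (m_closure m \<Gamma> K) (part_closure k \<Delta> L)
    \<subseteq> m_closure m (\<Delta> \<rightarrow>\<^sub>E \<Gamma>) (product_action \<Gamma> \<Delta> K L)"
proof
  fix f assume f: "f \<in> product_action \<Gamma> \<Delta> (m_closure m \<Gamma> K) (part_closure k \<Delta> L)"
  note Kc = perm_group_m_closure[OF K, of m] and Lc = perm_group_part_closure[OF L, of k]
  obtain g s where g: "g \<in> \<Delta> \<rightarrow>\<^sub>E m_closure m \<Gamma> K" and s: "s \<in> part_closure k \<Delta> L" "s \<in> Bij \<Delta>"
    and fgs: "f = product_perm \<Gamma> \<Delta> g s"
    using product_actionE[OF f Kc Lc] by blast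
  have fB: "f \<in> Bij (\<Delta> \<rightarrow>\<^sub>E \<Gamma>)" using f product_action_subset_Bij[OF Kc Lc] by blast
  have "\<exists>F\<in>product_action \<Gamma> \<Delta> K L. map f A = map F A" if A: "A \<in> tuples m (\<Delta> \<rightarrow>\<^sub>E \<Gamma>)" for A
  proof -
    have fA: "map f A \<in> tuples m (\<Delta> \<rightarrow>\<^sub>E \<Gamma>)" using on_tuples.act_closed[OF fB A] .
    define c where "c i = on_tuples.orb K (column (map f A) i)" for i
    have "c ` \<Delta> \<subseteq> Orb m \<Gamma> K" using column_tuples[OF fA] by (auto simp: c_def Orb_eq)
    then have "card (c ` \<Delta>) \<le> min (card (Orb m \<Gamma> K)) (card \<Delta>)"
      by (simp add: card_mono finite_Orb \<Gamma> \<Delta> card_image_le)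
    then have "card (c ` \<Delta>) \<le> k" using k by (rule order_trans)
    then obtain t where t: "t \<in> L" "\<And>j. j \<in> \<Delta> \<Longrightarrow> c (t j) = c (s j)"
      using part_closure_imp_colouring[OF L \<Delta> s(1)] by blast
    have "c (s j) = on_tuples.orb K (column A j)" if j: "j \<in> \<Delta>" for j
      unfolding c_def fgs by (rule column_product_perm_orb[OF K s(2) A j]) (use g j in blast)
    then show ?thesis unfolding product_action_orbit_iff[OF K L A fA] using t c_def by metis
  qed
  then show "f \<in> m_closure m (\<Delta> \<rightarrow>\<^sub>E \<Gamma>) (product_action \<Gamma> \<Delta> K L)"
    using m_closure_iff[OF perm_group_product_action[OF K L]] fB by blast
qed

text \<open>
  On a single pair of points the closure looks like the product action, and a pair can be extended to
  an \<open>m\<close>-tuple when \<open>m \<ge> 2\<close>.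
\<close>

lemma m_closure_product_action_isometry:
  assumes K: "perm_group \<Gamma> K" and L: "perm_group \<Delta> L" and m: "m \<ge> 2"
    and f: "f \<in> m_closure m (\<Delta> \<rightarrow>\<^sub>E \<Gamma>) (product_action \<Gamma> \<Delta> K L)"
    and x: "x \<in> \<Delta> \<rightarrow>\<^sub>E \<Gamma>" and y: "y \<in> \<Delta> \<rightarrow>\<^sub>E \<Gamma>"
  shows "card (differing \<Delta> (f x) (f y)) = card (differing \<Delta> x y)"
proof -
  have "x # replicate (m - 1) y \<in> tuples m (\<Delta> \<rightarrow>\<^sub>E \<Gamma>)" using x y m by (auto simp: tuples_def)
  then obtain F where F: "F \<in> product_action \<Gamma> \<Delta> K L"
      and eq: "map f (x # replicate (m - 1) y) = map F (x # replicate (m - 1) y)"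
    using f m_closure_iff[OF perm_group_product_action[OF K L]] by blast
  have "f x = F x" "f y = F y" using eq m by auto
  moreover obtain h t where "h \<in> \<Delta> \<rightarrow> Bij \<Gamma>" "t \<in> Bij \<Delta>" "F = product_perm \<Gamma> \<Delta> h t"
    using product_actionE[OF F K L] by blast
  ultimately show ?thesis using product_perm_isometry[of t \<Delta> h \<Gamma> x y] x y by simp
qed

text \<open>
  Once a member of the closure is known to have the form \<open>(g; s)\<close>, suitable matrices test its parts.
  A matrix with all columns equal to \<open>u\<close> is unaffected by permuting columns, so it tests each \<open>g j\<close> on \<open>u\<close>. A
  matrix whose columns have prescribed orbits realises a prescribed colouring with at most
  \<open>card (Orb m \<Gamma> K)\<close> colours, and so tests \<open>s\<close>.
\<close>

lemma m_closure_product_action_le: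
  fixes \<Gamma> :: "'a set" and \<Delta> :: "'b set"
  assumes \<Delta>: "finite \<Delta>" and \<Gamma>: "finite \<Gamma>" and K: "perm_group \<Gamma> K" and L: "perm_group \<Delta> L"
    and m: "m \<ge> 2" and k: "k \<le> card (Orb m \<Gamma> K)"
  shows "m_closure m (\<Delta> \<rightarrow>\<^sub>E \<Gamma>) (product_action \<Gamma> \<Delta> K L)
    \<subseteq> product_action \<Gamma> \<Delta> (m_closure m \<Gamma> K) (part_closure k \<Delta> L)"
proof
  fix f assume f: "f \<in> m_closure m (\<Delta> \<rightarrow>\<^sub>E \<Gamma>) (product_action \<Gamma> \<Delta> K L)"
  note iff = m_closure_iff[OF perm_group_product_action[OF K L], THEN iffD1, OF f]
  have fB: "f \<in> Bij (\<Delta> \<rightarrow>\<^sub>E \<Gamma>)" using iff by blast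
  obtain g s where g: "g \<in> \<Delta> \<rightarrow>\<^sub>E Bij \<Gamma>" and s: "s \<in> Bij \<Delta>" and fgs: "f = product_perm \<Gamma> \<Delta> g s"
    using Hamming_isometry_imp_product_perm[OF \<Gamma> \<Delta> Bij_imp_extensional[OF fB] Bij_in[OF fB]
      m_closure_product_action_isometry[OF K L m f]] by blast
  have match: "\<exists>t\<in>L. \<forall>j\<in>\<Delta>. on_tuples.orb K (column (map f A) (t j)) = on_tuples.orb K (column A j)"
    if A: "A \<in> tuples m (\<Delta> \<rightarrow>\<^sub>E \<Gamma>)" for A
    using iff A product_action_orbit_iff[OF K L A on_tuples.act_closed[OF fB A]] by blast
  have gK: "g j \<in> m_closure m \<Gamma> K" if j: "j \<in> \<Delta>" for j
  proof -
    have "\<exists>h\<in>K. map (g j) u = map h u" if u: "u \<in> tuples m \<Gamma>" for u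
    proof -
      have uc: "(\<lambda>j. u) \<in> \<Delta> \<rightarrow> tuples m \<Gamma>" using u by simp
      define A where "A = from_columns m \<Delta> (\<lambda>j. u)"
      have A: "A \<in> tuples m (\<Delta> \<rightarrow>\<^sub>E \<Gamma>)" unfolding A_def by (rule from_columns_tuples[OF uc])
      have colA: "column A i = u" if "i \<in> \<Delta>" for i
        unfolding A_def by (rule column_from_columns[OF uc that])
      obtain t where t: "t \<in> L" "\<forall>i\<in>\<Delta>. on_tuples.orb K (column (map f A) (t i)) = on_tuples.orb K (column A i)"
        using match[OF A] by blast
      have "t ` \<Delta> = \<Delta>" using t(1) perm_groupD(1)[OF L] by (auto simp: Bij_def bij_betw_def)
      then obtain i where i: "i \<in> \<Delta>" "t i = s j" using Bij_in[OF s j] by (metis imageE)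
      have "column (map f A) (s j) = map (g j) u"
        using column_product_perm[OF s A j, of g] colA[OF j] by (simp add: fgs)
      then have "on_tuples.orb K (map (g j) u) = on_tuples.orb K u"
        using t(2) i colA by metis
      moreover have "map (g j) u \<in> tuples m \<Gamma>" by (rule on_tuples.act_closed) (use g j u in blast)+
      ultimately have "map (g j) u \<in> on_tuples.orb K u" using on_tuples.orb_self[OF K] by metis
      then show ?thesis by (auto simp: on_tuples.orb_def)
    qed
    then show ?thesis using m_closure_iff[OF K] g j by blast
  qed
  have "s \<in> part_closure k \<Delta> L"
  proof (rule part_closure_of_colouring[OF L \<Delta> s])
    fix c :: "'b \<Rightarrow> 'b set" assume "card (c ` \<Delta>) \<le> k"
    then have "card (c ` \<Delta>) \<le> card (Orb m \<Gamma> K)" using k by simp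
    \<comment> \<open>There are enough orbits to let distinct colours correspond to distinct orbits.\<close>
    then obtain e where e: "e ` c ` \<Delta> \<subseteq> Orb m \<Gamma> K" "inj_on e (c ` \<Delta>)"
      using card_le_inj[of "c ` \<Delta>" "Orb m \<Gamma> K"] finite_Orb[OF \<Gamma>] \<Delta> by blast
    have "\<forall>v\<in>c ` \<Delta>. \<exists>u\<in>tuples m \<Gamma>. on_tuples.orb K u = e v" using e(1) by (force simp: Orb_eq)
    then obtain u where u: "\<And>v. v \<in> c ` \<Delta> \<Longrightarrow> u v \<in> tuples m \<Gamma>"
        "\<And>v. v \<in> c ` \<Delta> \<Longrightarrow> on_tuples.orb K (u v) = e v" by metis
    have uc: "(\<lambda>j. u (c (s j))) \<in> \<Delta> \<rightarrow> tuples m \<Gamma>" using u(1) Bij_in[OF s] by blast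
    \<comment> \<open>Composing with \<open>s\<close> makes \<open>c\<close> the colouring of the image of \<open>A\<close> under \<open>f\<close>.\<close>
    define A where "A = from_columns m \<Delta> (\<lambda>j. u (c (s j)))"
    have A: "A \<in> tuples m (\<Delta> \<rightarrow>\<^sub>E \<Gamma>)" unfolding A_def by (rule from_columns_tuples[OF uc])
    have orbA: "on_tuples.orb K (column A j) = e (c (s j))" if j: "j \<in> \<Delta>" for j
      unfolding A_def column_from_columns[OF uc j] using u(2) Bij_in[OF s j] by blast
    have orbfA: "on_tuples.orb K (column (map f A) i) = e (c i)" if i: "i \<in> \<Delta>" for i
    proof -
      define j where "j = inv_into \<Delta> s i"
      have j: "j \<in> \<Delta>" "s j = i" using inv_into_Bij[OF s i] by (simp_all add: j_def)
      show ?thesis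
        using column_product_perm_orb[where g = g, OF K s A j(1) gK[OF j(1)]] orbA[OF j(1)] by (simp add: fgs j(2))
    qed
    obtain t where t: "t \<in> L" "\<forall>j\<in>\<Delta>. on_tuples.orb K (column (map f A) (t j)) = on_tuples.orb K (column A j)"
      using match[OF A] by blast
    have tB: "t \<in> Bij \<Delta>" using t(1) perm_groupD(1)[OF L] by blast
    have "c (t j) = c (s j)" if j: "j \<in> \<Delta>" for j
    proof (rule inj_onD[OF e(2)])
      show "e (c (t j)) = e (c (s j))"
        using t(2) j orbA[OF j] orbfA[OF Bij_in[OF tB j]] by simp
    qed (use Bij_in[OF tB j] Bij_in[OF s j] in auto)
    then show "\<exists>t\<in>L. \<forall>j\<in>\<Delta>. c (t j) = c (s j)" using t(1) by blast
  qed
  moreover have "g \<in> \<Delta> \<rightarrow>\<^sub>E m_closure m \<Gamma> K" using g gK by (simp add: PiE_iff)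
  ultimately show "f \<in> product_action \<Gamma> \<Delta> (m_closure m \<Gamma> K) (part_closure k \<Delta> L)"
    unfolding fgs by (intro product_actionI)
qed

theorem theorem1p1:
  fixes \<Gamma> :: "'a set" and \<Delta> :: "'b set"
    and K :: "('a \<Rightarrow> 'a) set" and L :: "('b \<Rightarrow> 'b) set" and m d k_m k :: nat
  assumes "finite \<Gamma>" "\<Gamma> \<noteq> {}" and "finite \<Delta>" "\<Delta> \<noteq> {}"
    and "perm_group \<Gamma> K" and "perm_group \<Delta> L"
    and "m \<ge> 2"
    and "k_m = card (Orb m \<Gamma> K)" and "d = card \<Delta>" and "k = min k_m d"
  shows "m_closure m (\<Delta> \<rightarrow>\<^sub>E \<Gamma>) (product_action \<Gamma> \<Delta> K L) =
         product_action \<Gamma> \<Delta> (m_closure m \<Gamma> K) (part_closure k \<Delta> L)"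
proof
  show "m_closure m (\<Delta> \<rightarrow>\<^sub>E \<Gamma>) (product_action \<Gamma> \<Delta> K L)
      \<subseteq> product_action \<Gamma> \<Delta> (m_closure m \<Gamma> K) (part_closure k \<Delta> L)"
    using assms by (intro m_closure_product_action_le) auto
  show "product_action \<Gamma> \<Delta> (m_closure m \<Gamma> K) (part_closure k \<Delta> L)
      \<subseteq> m_closure m (\<Delta> \<rightarrow>\<^sub>E \<Gamma>) (product_action \<Gamma> \<Delta> K L)"
    using assms by (intro product_action_closures_le) auto
qed

end
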